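(* Let $\epsilon,\epsilon',\beta_0\in(0,1)$. Let $P\subset\mathbb{R}^d$ be a set of $n$ points which is an $(\epsilon^2,\beta)$-stable instance of the MEB problem for some $\beta>\beta_0$, and let $o$ be the center of $\mathbf{MEB}(P)$. Let $\tilde{o}\in\mathbb{R}^d$ and let $r$ be a number with $r\le(1+\epsilon'^2)\mathbf{Rad}(P)$. If the ball $\mathbb{B}(\tilde{o},r)$ contains at least $(1-\beta_0)n$ points of $P$, then $$\|\tilde{o}-o\|<(2\sqrt{2}\,\epsilon+\sqrt{3}\,\epsilon')\,\mathbf{Rad}(P).$$
   Context: For a finite set $P\subset\mathbb{R}^d$, $\mathbf{MEB}(P)$ denotes the closed ball of minimum radius containing $P$ and $\mathbf{Rad}(P)$ its radius; $\mathbb{B}(c,r)$ is the closed Euclidean ball with center $c$ and radius $r$. Given a set $P$ of $n$ points in $\mathbb{R}^d$ and $\alpha,\beta\in(0,1)$, $P$ is an $(\alpha,\beta)$-stable instance if (1) $\mathbf{Rad}(P\setminus Q)>(1-\alpha)\mathbf{Rad}(P)$ for every $Q\subset P$ with $|Q|<\beta n$, and (2) there exists $Q'\subset P$ with $|Q'|=\lceil\beta n\rceil$ and $\mathbf{Rad}(P\setminus Q')\le(1-\alpha)\mathbf{Rad}(P)$. *)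

theory Defs
  imports "HOL-Analysis.Analysis"
begin

definition is_MEB :: "'a::metric_space set \<Rightarrow> 'a \<Rightarrow> real \<Rightarrow> bool" where
  "is_MEB P c r \<longleftrightarrow>
     0 \<le> r \<and> P \<subseteq> cball c r \<and>
     (\<forall>c' r'. 0 \<le> r' \<longrightarrow> P \<subseteq> cball c' r' \<longrightarrow> r \<le> r')"

(* Convention: Rad {} = 0, cf. Rad_empty below. *)
definition Rad :: "'a::metric_space set \<Rightarrow> real" where
  "Rad P = (THE r. \<exists>c. is_MEB P c r)"

definition stable_instance :: "real \<Rightarrow> real \<Rightarrow> 'a::metric_space set \<Rightarrow> bool" where
  "stable_instance \<alpha> \<beta> P \<longleftrightarrow>
     finite P \<and> 0 < \<alpha> \<and> \<alpha> < 1 \<and> 0 < \<beta> \<and> \<beta> < 1 \<and>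
     (\<forall>Q\<subseteq>P. real (card Q) < \<beta> * real (card P) \<longrightarrow> Rad (P - Q) > (1 - \<alpha>) * Rad P) \<and>
     (\<exists>Q'\<subseteq>P. int (card Q') = \<lceil>\<beta> * real (card P)\<rceil> \<and> Rad (P - Q') \<le> (1 - \<alpha>) * Rad P)"

lemma Rad_eqI: "is_MEB P c r \<Longrightarrow> Rad P = r"
  unfolding Rad_def by (rule the_equality) (auto simp: is_MEB_def intro: antisym)

lemma is_MEB_empty: "is_MEB {} c 0"
  by (auto simp: is_MEB_def)

lemma Rad_empty: "Rad {} = 0"
  by (rule Rad_eqI[OF is_MEB_empty])

lemma is_MEB_exists:
  fixes P :: "'a::heine_borel set"
  assumes "bounded P"
  shows "\<exists>c. is_MEB P c (Rad P)"
proof (cases "P = {}")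
  case True
  then show ?thesis using is_MEB_empty by (simp add: Rad_empty) blast
next
  case False
  then obtain p where p: "p \<in> P" by blast
  obtain R where R: "0 \<le> R" "P \<subseteq> cball p R"
  proof -
    obtain e where "\<forall>q\<in>P. dist p q \<le> e"
      using assms bounded_any_center[of P p] by blast
    then have "P \<subseteq> cball p (max 0 e)" by force
    then show thesis using that[of "max 0 e"] by simp
  qed
  define S where "S = {x. \<forall>q\<in>P. dist (fst x) q \<le> snd x} \<inter> (cball p R \<times> {0..R})"
  have "closed {x :: 'a \<times> real. \<forall>q\<in>P. dist (fst x) q \<le> snd x}"
    unfolding Ball_def
    by (intro closed_Collect_all closed_Collect_imp open_Collect_const closed_Collect_le continuous_intros)
  then have "compact S"
    unfolding S_def by (intro closed_Int_compact compact_Times) auto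
  moreover have "(p, R) \<in> S"
    using R by (auto simp: S_def)
  ultimately obtain x where x: "x \<in> S" "\<And>y. y \<in> S \<Longrightarrow> snd x \<le> snd y"
    using continuous_attains_inf[of S snd] continuous_on_snd[OF continuous_on_id]
    by (metis empty_iff)
  have "snd x \<le> r'" if "0 \<le> r'" "P \<subseteq> cball c' r'" for c' r'
  proof (cases "r' \<le> R")
    case True
    then have "(c', r') \<in> S"
      using that p by (force simp: S_def dist_commute)
    then show ?thesis using x(2) by fastforce
  next
    case False
    then show ?thesis using x(1) by (auto simp: S_def)
  qed
  then have "is_MEB P (fst x) (snd x)"
    using x(1) by (auto simp: is_MEB_def S_def)
  then show ?thesis using Rad_eqI by metis
qed

lemma is_MEB_unique_center:
  fixes P :: "'a::euclidean_space set"
  assumes "P \<noteq> {}" "is_MEB P c r" "is_MEB P c' r"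
  shows "c = c'"
proof (rule ccontr)
  assume "c \<noteq> c'"
  define m where "m = (1/2) *\<^sub>R (c + c')"
  define s where "s = r\<^sup>2 - (norm (c - c') / 2)\<^sup>2"
  have b: "(dist m q)\<^sup>2 \<le> s" if "q \<in> P" for q
  proof -
    have d: "(norm (c - q))\<^sup>2 \<le> r\<^sup>2" "(norm (c' - q))\<^sup>2 \<le> r\<^sup>2"
      using assms that by (auto simp: is_MEB_def dist_norm intro!: power_mono)
    have "(dist m q)\<^sup>2 = ((norm (c - q))\<^sup>2 + (norm (c' - q))\<^sup>2) / 2 - (norm (c - c') / 2)\<^sup>2"
      by (simp add: m_def dist_norm power2_norm_eq_inner power_divide inner_simps inner_commute field_simps)
    then show ?thesis using d by (simp add: s_def)
  qed
  obtain q where "q \<in> P" using assms by blast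
  then have s0: "0 \<le> s" using b[of q] by (meson order_trans zero_le_power2)
  have "P \<subseteq> cball m (sqrt s)"
    using b by (auto intro!: real_le_rsqrt)
  then have "r \<le> sqrt s"
    using assms(2) s0 by (auto simp: is_MEB_def)
  moreover have "sqrt s < r"
    using assms(2) s0 \<open>c \<noteq> c'\<close> by (intro real_less_lsqrt) (auto simp: is_MEB_def s_def)
  ultimately show False by simp
qed

end

theory Submission
  imports Defs
begin

text \<open>
  If a set with minimum enclosing ball \<open>B(o, \<rho>)\<close> also lies in \<open>B(x, s)\<close>, then
  \<open>\<parallel>x - o\<parallel>\<^sup>2 \<le> s\<^sup>2 - \<rho>\<^sup>2\<close>. The points of \<open>P\<close> in the ball around \<open>c'\<close>
  form such a set, lying both in the minimum enclosing ball of \<open>P\<close> and in \<open>B(c', r)\<close>; by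
  stability \<open>\<rho> > (1 - \<epsilon>\<^sup>2) Rad P\<close>. Hence both \<open>c\<close> and \<open>c'\<close> are close to \<open>o\<close>.
\<close>

text \<open>Stewart's identity: the subtracted term quantifies the strong convexity of the squared
  distance to \<open>q\<close>.\<close>

lemma norm_sq_convex_combination:
  fixes x y q :: "'a::real_inner"
  shows "(norm (z *\<^sub>R x + (1 - z) *\<^sub>R y - q))\<^sup>2
    = z * (norm (x - q))\<^sup>2 + (1 - z) * (norm (y - q))\<^sup>2 - z * (1 - z) * (norm (y - x))\<^sup>2"
  by (simp add: power2_norm_eq_inner inner_simps inner_commute algebra_simps)

text \<open>Moving the optimal center slightly towards any other center cannot shrink the ball.\<close>

lemma is_MEB_center_dist:
  fixes P :: "'a::real_inner set"
  assumes "P \<noteq> {}" and meb: "is_MEB P x \<rho>" and sub: "P \<subseteq> cball y s"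
  shows "(norm (y - x))\<^sup>2 \<le> s\<^sup>2 - \<rho>\<^sup>2"
proof (rule field_le_mult_one_interval)
  \<comment> \<open>The bound is proved with an extra factor \<open>z\<close> on the left; letting
    \<open>z\<close> tend to 1 removes it.\<close>
  fix z :: real
  assume z: "0 < z" "z < 1"
  define m where "m = z *\<^sub>R x + (1 - z) *\<^sub>R y"
  define u where "u = z * \<rho>\<^sup>2 + (1 - z) * s\<^sup>2 - z * (1 - z) * (norm (y - x))\<^sup>2"
  have b: "(dist m q)\<^sup>2 \<le> u" if "q \<in> P" for q
  proof -
    have "(norm (x - q))\<^sup>2 \<le> \<rho>\<^sup>2" "(norm (y - q))\<^sup>2 \<le> s\<^sup>2"
      using meb sub that by (auto simp: is_MEB_def dist_norm intro!: power_mono)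
    then have "z * (norm (x - q))\<^sup>2 + (1 - z) * (norm (y - q))\<^sup>2 \<le> z * \<rho>\<^sup>2 + (1 - z) * s\<^sup>2"
      using z by (intro add_mono mult_left_mono) auto
    then show ?thesis
      by (simp add: dist_norm m_def u_def norm_sq_convex_combination)
  qed
  \<comment> \<open>A point of \<open>P\<close> is needed to see that \<open>u\<close> is
    nonnegative, so that \<open>sqrt u\<close> is an admissible radius.\<close>
  obtain q where "q \<in> P" using assms(1) by blast
  then have u0: "0 \<le> u" using b[of q] by (meson order_trans zero_le_power2)
  have "P \<subseteq> cball m (sqrt u)"
    using b by (auto intro!: real_le_rsqrt)
  then have "\<rho> \<le> sqrt u" and "0 \<le> \<rho>"
    using meb u0 by (auto simp: is_MEB_def)
  then have "\<rho>\<^sup>2 \<le> u"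
    using u0 by (metis power_mono real_sqrt_pow2)
  \<comment> \<open>Subtracting \<open>z * \<rho>\<^sup>2\<close> leaves the positive factor
    \<open>1 - z\<close> on both sides.\<close>
  then have "(1 - z) * (z * (norm (y - x))\<^sup>2) \<le> (1 - z) * (s\<^sup>2 - \<rho>\<^sup>2)"
    by (simp add: u_def algebra_simps)
  then show "z * (norm (y - x))\<^sup>2 \<le> s\<^sup>2 - \<rho>\<^sup>2"
    using z by simp
qed

text \<open>Removing the empty set must already beat the factor \<open>1 - \<alpha>\<close>, which
  is impossible at radius 0.\<close>

lemma stable_instance_Rad_pos:
  assumes "stable_instance \<alpha> \<beta> P" "P \<noteq> {}"
  shows "Rad P > 0"
proof -
  have "finite P" "0 < \<alpha>" "0 < \<beta>"
    and *: "\<And>Q. Q \<subseteq> P \<Longrightarrow> real (card Q) < \<beta> * real (card P) \<Longrightarrow> Rad (P - Q) > (1 - \<alpha>) * Rad P"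
    using assms(1) by (auto simp: stable_instance_def)
  then have "Rad P > (1 - \<alpha>) * Rad P"
    using *[of "{}"] assms(2) by (simp add: card_gt_0_iff)
  then have "0 < \<alpha> * Rad P"
    by (simp add: algebra_simps)
  then show ?thesis
    using \<open>0 < \<alpha>\<close> by (simp add: zero_less_mult_iff)
qed

text \<open>The complement \<open>P - S\<close> is small enough to serve as the removed set in the
  stability condition.\<close>

lemma stable_instance_Rad_large_subset:
  assumes "stable_instance \<alpha> \<beta> P" "S \<subseteq> P"
    and "real (card S) > (1 - \<beta>) * real (card P)"
  shows "Rad S > (1 - \<alpha>) * Rad P"
proof -
  have fin: "finite P"
    and *: "\<And>Q. Q \<subseteq> P \<Longrightarrow> real (card Q) < \<beta> * real (card P) \<Longrightarrow> Rad (P - Q) > (1 - \<alpha>) * Rad P"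
    using assms(1) by (auto simp: stable_instance_def)
  have "real (card (P - S)) = real (card P) - real (card S)"
    using fin assms(2) by (simp add: card_Diff_subset card_mono finite_subset of_nat_diff)
  then have "real (card (P - S)) < \<beta> * real (card P)"
    using assms(3) by (simp add: algebra_simps)
  then have "Rad (P - (P - S)) > (1 - \<alpha>) * Rad P"
    by (intro *) auto
  then show ?thesis
    using assms(2) by (simp add: double_diff)
qed

theorem theorem2:
  fixes P :: "(real ^ 'd) set" and c c' :: "real ^ 'd"
    and \<epsilon> \<epsilon>' \<beta>\<^sub>0 \<beta> r :: real
  assumes "0 < \<epsilon>" "\<epsilon> < 1"
    and "0 < \<epsilon>'" "\<epsilon>' < 1"
    and "0 < \<beta>\<^sub>0" "\<beta>\<^sub>0 < 1"
    and "finite P" "P \<noteq> {}"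
    and "\<beta> > \<beta>\<^sub>0"
    and "stable_instance (\<epsilon>\<^sup>2) \<beta> P"
    and "is_MEB P c (Rad P)"
    and "r \<le> (1 + \<epsilon>'\<^sup>2) * Rad P"
    and "real (card (P \<inter> cball c' r)) \<ge> (1 - \<beta>\<^sub>0) * real (card P)"
  shows "norm (c' - c) < (2 * sqrt 2 * \<epsilon> + sqrt 3 * \<epsilon>') * Rad P"
proof -
  define S where "S = P \<inter> cball c' r"
  define R where "R = Rad P"
  have R: "R > 0"
    using stable_instance_Rad_pos assms by (auto simp: R_def)
  have "(1 - \<beta>) * real (card P) < (1 - \<beta>\<^sub>0) * real (card P)"
    using assms by (intro mult_strict_right_mono) (auto simp: card_gt_0_iff)
  then have large: "Rad S > (1 - \<epsilon>\<^sup>2) * R"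
    unfolding R_def using assms
    by (intro stable_instance_Rad_large_subset[of _ \<beta>]) (auto simp: S_def)
  have e1: "\<epsilon>\<^sup>2 < 1" "\<epsilon>'\<^sup>2 < 1"
    using assms(1-4) by (auto simp: power_less_one_iff)
  then have low: "0 < (1 - \<epsilon>\<^sup>2) * R"
    using R by simp
  \<comment> \<open>This uses the convention that the empty set has radius 0.\<close>
  then have S: "S \<noteq> {}"
    using large by (auto simp: Rad_empty)
  have "bounded S"
    using assms by (simp add: S_def finite_imp_bounded)
  then obtain x where x: "is_MEB S x (Rad S)"
    using is_MEB_exists by blast
  have Rad_S: "((1 - \<epsilon>\<^sup>2) * R)\<^sup>2 < (Rad S)\<^sup>2"
    using large low by (intro power_strict_mono) auto
  have "(norm (c - x))\<^sup>2 \<le> R\<^sup>2 - (Rad S)\<^sup>2"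
    using assms(11) by (intro is_MEB_center_dist[OF S x]) (auto simp: is_MEB_def S_def R_def)
  also have "\<dots> < R\<^sup>2 - ((1 - \<epsilon>\<^sup>2) * R)\<^sup>2"
    using Rad_S by simp
  \<comment> \<open>The constant \<open>sqrt 2\<close> comes from expanding
    \<open>1 - (1 - \<epsilon>\<^sup>2)\<^sup>2\<close>.\<close>
  also have "\<dots> = (sqrt 2 * \<epsilon> * R)\<^sup>2 - (\<epsilon>\<^sup>2 * R)\<^sup>2"
    by (simp add: power2_eq_square algebra_simps)
  also have "\<dots> \<le> (sqrt 2 * \<epsilon> * R)\<^sup>2"
    by simp
  finally have c: "norm (c - x) < sqrt 2 * \<epsilon> * R"
    by (rule power2_less_imp_less) (use assms(1) R in simp)
  \<comment> \<open>The sign of \<open>r\<close> is not assumed: it follows from a point lying in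
    the ball, and it permits squaring the upper bound on \<open>r\<close>.\<close>
  have "r \<ge> 0"
    using S by (auto simp: S_def dest: order_trans[OF zero_le_dist])
  then have r: "r\<^sup>2 \<le> ((1 + \<epsilon>'\<^sup>2) * R)\<^sup>2"
    using assms(12) by (intro power_mono) (auto simp: R_def)
  have "(norm (c' - x))\<^sup>2 \<le> r\<^sup>2 - (Rad S)\<^sup>2"
    by (intro is_MEB_center_dist[OF S x]) (auto simp: S_def)
  also have "\<dots> \<le> ((1 + \<epsilon>'\<^sup>2) * R)\<^sup>2 - ((1 - \<epsilon>\<^sup>2) * R)\<^sup>2"
    using Rad_S r by simp
  also have "\<dots> = (2 * \<epsilon>'\<^sup>2 + \<epsilon>'\<^sup>2 * \<epsilon>'\<^sup>2 + 2 * \<epsilon>\<^sup>2 - (\<epsilon>\<^sup>2)\<^sup>2) * R\<^sup>2"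
    by (simp add: power2_eq_square algebra_simps)
  \<comment> \<open>Absorbing the fourth power of \<open>\<epsilon>'\<close> into its square turns 2
    into 3; the added cross term completes the square.\<close>
  also have "\<dots> \<le> (3 * \<epsilon>'\<^sup>2 + 2 * \<epsilon>\<^sup>2 + 2 * (sqrt 3 * \<epsilon>') * (sqrt 2 * \<epsilon>)) * R\<^sup>2"
  proof (rule mult_right_mono)
    have "\<epsilon>'\<^sup>2 * \<epsilon>'\<^sup>2 \<le> \<epsilon>'\<^sup>2"
      using e1 by (intro mult_left_le) auto
    moreover have "0 \<le> 2 * (sqrt 3 * \<epsilon>') * (sqrt 2 * \<epsilon>)"
      using assms(1,3) by simp
    moreover have "0 \<le> (\<epsilon>\<^sup>2)\<^sup>2"
      by simp
    ultimately show "2 * \<epsilon>'\<^sup>2 + \<epsilon>'\<^sup>2 * \<epsilon>'\<^sup>2 + 2 * \<epsilon>\<^sup>2 - (\<epsilon>\<^sup>2)\<^sup>2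
        \<le> 3 * \<epsilon>'\<^sup>2 + 2 * \<epsilon>\<^sup>2 + 2 * (sqrt 3 * \<epsilon>') * (sqrt 2 * \<epsilon>)"
      by linarith
  qed simp
  also have "\<dots> = ((sqrt 3 * \<epsilon>' + sqrt 2 * \<epsilon>) * R)\<^sup>2"
    by (simp add: power_mult_distrib power2_sum)
  finally have c': "norm (c' - x) \<le> (sqrt 3 * \<epsilon>' + sqrt 2 * \<epsilon>) * R"
    by (rule power2_le_imp_le) (use assms(1,3) R in simp)
  have "norm (c' - c) \<le> norm (c' - x) + norm (c - x)"
    using norm_triangle_ineq4[of "c' - x" "c - x"] by simp
  \<comment> \<open>Strictness comes from the bound on \<open>norm (c - x)\<close>; each leg of the
    triangle contributes one \<open>sqrt 2 * \<epsilon>\<close>.\<close>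
  also have "\<dots> < (sqrt 3 * \<epsilon>' + sqrt 2 * \<epsilon>) * R + sqrt 2 * \<epsilon> * R"
    using c c' by linarith
  also have "\<dots> = (2 * sqrt 2 * \<epsilon> + sqrt 3 * \<epsilon>') * Rad P"
    by (simp add: R_def algebra_simps)
  finally show ?thesis .
qed

end
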